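(* Let $0<\beta<1$, $f:\mathbb{R}\to\mathbb{R}$, $x\in\mathbb{R}$, and let $f$ belong to the regular Hölder class $\mathbb{H}^{r,\beta}$ at $x$. Fix one of the signs $\pm$. If $\upsilon^{\beta}_{\pm}f(x)\neq0$, then the function $y\mapsto\upsilon^{\beta}_{\pm}f(y)$ is discontinuous at $x$ (i.e. not continuous at $x$), and the set $\chi^{\beta}_{+}(f)$ is totally disconnected.
   Context: For $\epsilon>0$ put $\Delta^{+}_{\epsilon}[f](x)=f(x+\epsilon)-f(x)$ and $\Delta^{-}_{\epsilon}[f](x)=f(x)-f(x-\epsilon)$. The fractional velocity of order $\beta$ is $\upsilon^{\beta}_{\pm}f(x)=\lim_{\epsilon\to0^+}\Delta^{\pm}_{\epsilon}[f](x)/\epsilon^{\beta}$. $f$ is called $\beta$-differentiable at $x$ if at least one of $\upsilon^{\beta}_{+}f(x)$, $\upsilon^{\beta}_{-}f(x)$ exists finitely. $f$ is of Hölder class $\mathbb{H}^{\beta}$ at $x$ if there are $C,\delta>0$ with $|f(x)-f(y)|\le C|x-y|^{\beta}$ whenever $|x-y|\le\delta$. The regular class $\mathbb{H}^{r,\beta}$ at $x$ consists of those $f$ in $\mathbb{H}^{\beta}$ at $x$ that are $\beta$-differentiable at $x$ (equivalently, whose difference quotients $\Delta^{\pm}_{\epsilon}[f](x)/\epsilon^\beta$ have oscillation, as functions of $\epsilon$, vanishing as $\epsilon\to0^+$). The set of change is $\chi^{\beta}_{\pm}(f)=\{x:\ \upsilon^{\beta}_{\pm}f(x)\text{ exists finitely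 and }\upsilon^{\beta}_{\pm}f(x)\neq0\}$. Continuity of $\upsilon^{\beta}_{\pm}f$ at $x$ presupposes that $\upsilon^\beta_\pm f$ exists finitely at all points near $x$ (including $x$). *)

theory Defs
  imports "HOL-Analysis.Analysis"
begin

datatype side = Forward | Backward

fun side_diff :: "side \<Rightarrow> real \<Rightarrow> (real \<Rightarrow> real) \<Rightarrow> real \<Rightarrow> real" where
  "side_diff Forward \<epsilon> f x = f (x + \<epsilon>) - f x"
| "side_diff Backward \<epsilon> f x = f x - f (x - \<epsilon>)"

definition has_frac_velocity ::
    "side \<Rightarrow> real \<Rightarrow> (real \<Rightarrow> real) \<Rightarrow> real \<Rightarrow> real \<Rightarrow> bool" where
  "has_frac_velocity s \<beta> f x v \<longleftrightarrow>
     ((\<lambda>\<epsilon>. side_diff s \<epsilon> f x / \<epsilon> powr \<beta>) \<longlongrightarrow> v) (at_right 0)"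

definition frac_velocity_exists :: "side \<Rightarrow> real \<Rightarrow> (real \<Rightarrow> real) \<Rightarrow> real \<Rightarrow> bool" where
  "frac_velocity_exists s \<beta> f x \<longleftrightarrow> (\<exists>v. has_frac_velocity s \<beta> f x v)"

text \<open>The value below is meaningful only where the velocity exists as a finite limit; every use
  is therefore guarded by \<open>frac_velocity_exists\<close>.\<close>

definition frac_velocity :: "side \<Rightarrow> real \<Rightarrow> (real \<Rightarrow> real) \<Rightarrow> real \<Rightarrow> real" where
  "frac_velocity s \<beta> f x = Lim (at_right 0) (\<lambda>\<epsilon>. side_diff s \<epsilon> f x / \<epsilon> powr \<beta>)"

definition beta_differentiable :: "real \<Rightarrow> (real \<Rightarrow> real) \<Rightarrow> real \<Rightarrow> bool" where
  "beta_differentiable \<beta> f x \<longleftrightarrow>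
     frac_velocity_exists Forward \<beta> f x \<or> frac_velocity_exists Backward \<beta> f x"

definition holder_at :: "real \<Rightarrow> (real \<Rightarrow> real) \<Rightarrow> real \<Rightarrow> bool" where
  "holder_at \<beta> f x \<longleftrightarrow>
     (\<exists>C>0. \<exists>\<delta>>0. \<forall>y. \<bar>x - y\<bar> \<le> \<delta> \<longrightarrow> \<bar>f x - f y\<bar> \<le> C * \<bar>x - y\<bar> powr \<beta>)"

definition regular_holder_at :: "real \<Rightarrow> (real \<Rightarrow> real) \<Rightarrow> real \<Rightarrow> bool" where
  "regular_holder_at \<beta> f x \<longleftrightarrow> holder_at \<beta> f x \<and> beta_differentiable \<beta> f x"

definition set_of_change :: "side \<Rightarrow> real \<Rightarrow> (real \<Rightarrow> real) \<Rightarrow> real set" where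
  "set_of_change s \<beta> f = {x. frac_velocity_exists s \<beta> f x \<and> frac_velocity s \<beta> f x \<noteq> 0}"

text \<open>The velocity is a partial function, so its continuity at a point includes its existence on
  a whole neighbourhood. The filter \<open>nhds x\<close>, unlike \<open>at x\<close>, covers the point \<open>x\<close> itself.\<close>

definition frac_velocity_continuous_at :: "side \<Rightarrow> real \<Rightarrow> (real \<Rightarrow> real) \<Rightarrow> real \<Rightarrow> bool" where
  "frac_velocity_continuous_at s \<beta> f x \<longleftrightarrow>
     (\<forall>\<^sub>F y in nhds x. frac_velocity_exists s \<beta> f y) \<and> isCont (frac_velocity s \<beta> f) x"

definition totally_disconnected :: "'a::topological_space set \<Rightarrow> bool" where
  "totally_disconnected S \<longleftrightarrow>
     (\<forall>T. T \<subseteq> S \<longrightarrow> connected T \<longrightarrow> T = {} \<or> (\<exists>a. T = {a}))"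

end

theory Submission
  imports Defs "HOL-Real_Asymp.Real_Asymp"
begin

text \<open>
  A nonzero velocity at a point \<open>y\<close> forces \<open>\<bar>f (y + e) - f y\<bar> \<ge> e powr \<beta> / n\<close>, with constant sign, for
  all \<open>0 < e < 1 / n\<close> and some \<open>n\<close>. If this happened at every point of an interval, then by Baire's
  theorem the same \<open>n\<close> and the same sign would serve on a dense subset of a subinterval, and by
  right-continuity of \<open>f\<close> on the whole subinterval. This is absurd: chopping a segment of length
  \<open>h\<close> into \<open>N\<close> equal pieces, the increment of \<open>f\<close> over it would be at least
  \<open>N * (h / N) powr \<beta> / n\<close>, which is unbounded in \<open>N\<close> as \<open>\<beta> < 1\<close>.
\<close>

text \<open>The increment is the convergent quotient times \<open>e powr \<beta>\<close>, and this
  factor tends to 0.\<close>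

lemma has_frac_velocity_Forward_imp_right_continuous:
  assumes "has_frac_velocity Forward \<beta> f y v" "0 < \<beta>"
  shows "(f \<longlongrightarrow> f y) (at_right y)"
proof -
  have "((\<lambda>e::real. e powr \<beta>) \<longlongrightarrow> 0) (at_right 0)"
    using \<open>0 < \<beta>\<close> by real_asymp
  with assms(1) have "((\<lambda>e. side_diff Forward e f y / e powr \<beta> * e powr \<beta>) \<longlongrightarrow> v * 0) (at_right 0)"
    unfolding has_frac_velocity_def by (rule tendsto_mult)
  moreover have "\<forall>\<^sub>F e in at_right 0. side_diff Forward e f y / e powr \<beta> * e powr \<beta> = f (y + e) - f y"
    using eventually_at_right_less[of "0::real"] by eventually_elim simp
  ultimately have "((\<lambda>e. f (y + e) - f y) \<longlongrightarrow> 0) (at_right 0)"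
    using tendsto_cong by force
  then have "((\<lambda>e. f (y + e)) \<longlongrightarrow> f y) (at_right 0)"
    by (simp add: LIM_zero_iff)
  then show ?thesis
    by (subst filterlim_at_right_to_0) (simp add: add.commute)
qed

lemma no_sublinear_lower_increment_bound:
  fixes g :: "real \<Rightarrow> real"
  assumes "c < d" "0 < C" "\<beta> < 1"
    and steep: "\<And>y z. \<lbrakk>c < y; y < z; z < d\<rbrakk> \<Longrightarrow> C * (z - y) powr \<beta> \<le> g z - g y"
  shows False
proof -
  obtain y z where yz: "c < y" "y < z" "z < d"
    using dense \<open>c < d\<close> by metis
  define h where "h = z - y"
  have h: "0 < h" using yz by (simp add: h_def)
  \<comment> \<open>The product equals \<open>C * h powr \<beta> * real N powr (1 - \<beta>)\<close>
    for positive \<open>N\<close>, and the exponent \<open>1 - \<beta>\<close> is positive.\<close>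
  have "filterlim (\<lambda>N::nat. real N * (C * (h / real N) powr \<beta>)) at_top sequentially"
    using h \<open>0 < C\<close> \<open>\<beta> < 1\<close> by real_asymp
  then have "\<forall>\<^sub>F N in sequentially. g z - g y < real N * (C * (h / real N) powr \<beta>)"
    by (simp add: filterlim_at_top_dense)
  then have "\<forall>\<^sub>F N in sequentially. 0 < N \<and> g z - g y < real N * (C * (h / real N) powr \<beta>)"
    using eventually_gt_at_top by (intro eventually_conj)
  then obtain N :: nat where N: "0 < N" "g z - g y < real N * (C * (h / real N) powr \<beta>)"
    using eventually_happens' sequentially_bot by blast
  define t where "t = h / real N"
  have t: "0 < t" "real N * t = h" using h N by (simp_all add: t_def)
  \<comment> \<open>The increments over consecutive steps of length \<open>t\<close> telescope, each
    contributing at least \<open>C * t powr \<beta>\<close>.\<close>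
  have "real i * (C * t powr \<beta>) \<le> g (y + real i * t) - g y" if "i \<le> N" for i
    using that
  proof (induction i)
    case (Suc i)
    have "real (Suc i) * t \<le> real N * t"
      using Suc.prems t by (intro mult_right_mono) auto
    then have "y + real (Suc i) * t < d" using yz t h_def by linarith
    moreover have "c < y + real i * t" using yz t by (simp add: add_pos_nonneg add_strict_increasing2 less_le_trans)
    moreover have "y + real i * t < y + real (Suc i) * t" using t by (simp add: algebra_simps)
    ultimately have "C * ((y + real (Suc i) * t) - (y + real i * t)) powr \<beta>
        \<le> g (y + real (Suc i) * t) - g (y + real i * t)"
      by (intro steep)
    moreover have "(y + real (Suc i) * t) - (y + real i * t) = t" by (simp add: algebra_simps)
    ultimately have "C * t powr \<beta> \<le> g (y + real (Suc i) * t) - g (y + real i * t)"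
      by simp
    moreover have "real i * (C * t powr \<beta>) \<le> g (y + real i * t) - g y"
      using Suc by simp
    moreover have "real (Suc i) * (C * t powr \<beta>) = real i * (C * t powr \<beta>) + C * t powr \<beta>"
      by (simp add: algebra_simps)
    ultimately show ?case by linarith
  qed simp
  from this[of N] have "real N * (C * t powr \<beta>) \<le> g z - g y"
    by (simp add: t h_def)
  with N show False by (simp add: t_def)
qed

text \<open>For fixed \<open>z\<close>, the bound between \<open>q\<close> and \<open>z\<close>
  holds for every \<open>q\<close> in \<open>A\<close> slightly to the right of \<open>y\<close>.
  Letting \<open>q\<close> tend to \<open>y\<close> gives it for \<open>y\<close> and
  \<open>z\<close>; only right-continuity at \<open>y\<close> enters, since \<open>z\<close> stays
  put.\<close>

lemma no_dense_uniform_sublinear_growth: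
  fixes g :: "real \<Rightarrow> real"
  assumes "c < d" "0 < C" "0 < r" "0 < \<beta>" "\<beta> < 1"
    and cont: "\<And>y. \<lbrakk>c < y; y < d\<rbrakk> \<Longrightarrow> (g \<longlongrightarrow> g y) (at_right y)"
    and dense: "{c<..<d} \<subseteq> closure A"
    and steep: "\<And>y e. \<lbrakk>y \<in> A; 0 < e; e < r\<rbrakk> \<Longrightarrow> C * e powr \<beta> \<le> g (y + e) - g y"
  shows False
proof (rule no_sublinear_lower_increment_bound)
  \<comment> \<open>Capping the length at \<open>r\<close> makes \<open>z - q < r\<close> for all
    \<open>q\<close> between \<open>y\<close> and \<open>z\<close>, so \<open>steep\<close> applies
    with \<open>e = z - q\<close>.\<close>
  show "c < min d (c + r)" using assms by simp
  fix y z assume yz: "c < y" "y < z" "z < min d (c + r)"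
  let ?F = "at y within (A \<inter> {y<..<z})"
  have "y islimpt (A \<inter> {y<..<z})"
    unfolding islimpt_approachable
  proof (intro allI impI)
    fix e :: real assume "0 < e"
    \<comment> \<open>The ball of radius \<open>m / 2\<close> about \<open>y + m / 2\<close> lies to
      the right of \<open>y\<close>, below \<open>z\<close> and within \<open>e\<close> of
      \<open>y\<close>; density puts a point of \<open>A\<close> in it.\<close>
    define m where "m = min e (z - y)"
    have m: "0 < m" "m \<le> e" "m \<le> z - y" using yz \<open>0 < e\<close> by (auto simp: m_def)
    then have "y + m / 2 \<in> closure A" using dense yz by auto
    moreover have "0 < m / 2" using m by simp
    ultimately obtain q where "q \<in> A" "dist q (y + m / 2) < m / 2"
      unfolding closure_approachable by blast
    moreover from this have "y < q" "q < z" "q - y < e"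
      using m unfolding dist_real_def by linarith+
    ultimately show "\<exists>q\<in>A \<inter> {y<..<z}. q \<noteq> y \<and> dist q y < e"
      by (intro bexI[of _ q]) (auto simp: dist_real_def)
  qed
  then have nontriv: "?F \<noteq> bot"
    by (simp add: trivial_limit_within)
  have "?F \<le> at_right y"
    by (rule at_le) auto
  then have "(g \<longlongrightarrow> g y) ?F"
    using cont[of y] yz by (auto intro: tendsto_mono)
  then have "((\<lambda>q. g z - g q) \<longlongrightarrow> g z - g y) ?F"
    by (intro tendsto_intros)
  moreover have "((\<lambda>q. C * (z - q) powr \<beta>) \<longlongrightarrow> C * (z - y) powr \<beta>) ?F"
    using yz by (intro tendsto_intros) auto
  moreover have "\<forall>\<^sub>F q in ?F. C * (z - q) powr \<beta> \<le> g z - g q"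
    unfolding eventually_at_filter
    using steep[of q "z - q" for q] yz by (intro always_eventually) auto
  ultimately show "C * (z - y) powr \<beta> \<le> g z - g y"
    using nontriv by (intro tendsto_le[of ?F])
qed (use assms in auto)

lemma Forward_velocity_not_nonzero_on_interval:
  assumes "0 < \<beta>" "\<beta> < 1" "a < b"
    and vel: "\<And>y. \<lbrakk>a < y; y < b\<rbrakk> \<Longrightarrow> \<exists>v. v \<noteq> 0 \<and> has_frac_velocity Forward \<beta> f y v"
  shows False
proof -
  \<comment> \<open>One index \<open>n\<close> controls both the range of \<open>e\<close> and the
    constant. The factor \<open>\<sigma>\<close> turns steep decrease of \<open>f\<close> into steep
    growth of \<open>\<sigma> * f\<close>.\<close>
  define A where "A = (\<lambda>(n::nat, \<sigma>::real). {y. \<forall>e. 0 < e \<longrightarrow> e < 1 / real (Suc n) \<longrightarrow>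
      1 / real (Suc n) * e powr \<beta> \<le> \<sigma> * f (y + e) - \<sigma> * f y})"
  have cover: "\<exists>n. \<exists>\<sigma>\<in>{1, -1}. y \<in> A (n, \<sigma>)" if y: "a < y" "y < b" for y
  proof -
    obtain v where v: "v \<noteq> 0" and lim: "((\<lambda>e. side_diff Forward e f y / e powr \<beta>) \<longlongrightarrow> v) (at_right 0)"
      using vel[OF y] unfolding has_frac_velocity_def by blast
    have "((\<lambda>e. sgn v * (side_diff Forward e f y / e powr \<beta>)) \<longlongrightarrow> sgn v * v) (at_right 0)"
      using lim by (intro tendsto_intros)
    moreover have "\<bar>v\<bar> / 2 < sgn v * v" using v by (simp add: sgn_if)
    ultimately have "\<forall>\<^sub>F e in at_right 0. \<bar>v\<bar> / 2 < sgn v * (side_diff Forward e f y / e powr \<beta>)"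
      by (rule order_tendstoD(1))
    then obtain r where r: "0 < r"
      "\<And>e. 0 < e \<Longrightarrow> e < r \<Longrightarrow> \<bar>v\<bar> / 2 < sgn v * (side_diff Forward e f y / e powr \<beta>)"
      unfolding eventually_at_right_field by blast
    obtain n where n: "1 / real (Suc n) < min r (\<bar>v\<bar> / 2)"
      using reals_Archimedean[of "min r (\<bar>v\<bar> / 2)"] r v by (auto simp: inverse_eq_divide)
    have "y \<in> A (n, sgn v)"
      unfolding A_def
    proof (clarsimp simp del: of_nat_Suc)
      fix e assume e: "0 < e" "e < 1 / real (Suc n)"
      have "1 / real (Suc n) < sgn v * (side_diff Forward e f y / e powr \<beta>)"
        using r(2)[of e] n e by linarith
      then have "1 / real (Suc n) * e powr \<beta> \<le> sgn v * side_diff Forward e f y"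
        using e by (simp add: pos_less_divide_eq del: of_nat_Suc)
      then show "e powr \<beta> / real (Suc n) \<le> sgn v * f (y + e) - sgn v * f y"
        by (simp add: right_diff_distrib del: of_nat_Suc)
    qed
    then show ?thesis using v by (auto simp: sgn_if split: if_splits)
  qed
  define I where "I = (UNIV :: nat set) \<times> {1, -1::real}"
  \<comment> \<open>Baire's theorem is applied in a closed interval, whose endpoints must still be
    covered by the sets \<open>A (n, \<sigma>)\<close>.\<close>
  obtain a' b' where ab: "a < a'" "a' < b'" "b' < b"
    using dense \<open>a < b\<close> by metis
  let ?S = "{a'..b'}"
  let ?G = "(\<lambda>i. ?S - closure (A i)) ` I"
  \<comment> \<open>Otherwise the complements of the closures would be countably many dense,
    relatively open subsets of \<open>?S\<close>. Their intersection would be dense, yet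
    \<open>cover\<close> makes it empty.\<close>
  have "\<exists>i\<in>I. \<not> ?S \<subseteq> closure (?S - closure (A i))"
  proof (rule ccontr)
    assume "\<not> ?thesis"
    moreover have "openin (top_of_set ?S) (?S - closure U)" for U
      by (simp add: Diff_eq openin_open_Int open_Compl)
    moreover have "countable ?G" by (simp add: I_def)
    ultimately have "?S \<subseteq> closure (\<Inter>?G)"
      by (intro Baire) auto
    moreover have "\<Inter>?G = {}"
    proof -
      have False if "y \<in> \<Inter>?G" for y
      proof -
        have "y \<in> ?S" using that by (auto simp: I_def)
        then obtain n \<sigma> where "\<sigma> \<in> {1, -1}" "y \<in> A (n, \<sigma>)"
          using cover[of y] ab by auto
        then have "y \<notin> ?S - closure (A (n, \<sigma>))" "(n, \<sigma>) \<in> I"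
          using closure_subset by (auto simp: I_def)
        with that show False by blast
      qed
      then show ?thesis by blast
    qed
    ultimately show False using ab by auto
  qed
  then obtain n \<sigma> p where \<sigma>: "\<sigma> \<in> {1, -1}" and p: "p \<in> ?S" "p \<notin> closure (?S - closure (A (n, \<sigma>)))"
    unfolding I_def by blast
  then obtain e where e: "0 < e" "\<And>q. q \<in> ?S \<Longrightarrow> dist q p < e \<Longrightarrow> q \<in> closure (A (n, \<sigma>))"
    unfolding closure_approachable[of p] by blast
  show False
  proof (rule no_dense_uniform_sublinear_growth)
    \<comment> \<open>Since \<open>p\<close> may be an endpoint of \<open>?S\<close>, the ball about
      it is cut down to the part inside \<open>{a'<..<b'}\<close>.\<close>
    show "max a' (p - e) < min b' (p + e)" using p ab e by auto
    show "{max a' (p - e)<..<min b' (p + e)} \<subseteq> closure (A (n, \<sigma>))"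
      using e(2) by (auto simp: dist_real_def)
    show "((\<lambda>y. \<sigma> * f y) \<longlongrightarrow> \<sigma> * f y) (at_right y)"
      if "max a' (p - e) < y" "y < min b' (p + e)" for y
    proof -
      have "a < y" "y < b" using that ab by auto
      then obtain v where "has_frac_velocity Forward \<beta> f y v" using vel[of y] by blast
      then show ?thesis
        using has_frac_velocity_Forward_imp_right_continuous \<open>0 < \<beta>\<close> by (intro tendsto_intros)
    qed
    show "1 / real (Suc n) * t powr \<beta> \<le> \<sigma> * f (y + t) - \<sigma> * f y"
      if "y \<in> A (n, \<sigma>)" "0 < t" "t < 1 / real (Suc n)" for y t
      using that unfolding A_def by blast
  qed (use assms in auto)
qed

lemma has_frac_velocity_frac_velocity:
  "frac_velocity_exists s \<beta> f x \<Longrightarrow> has_frac_velocity s \<beta> f x (frac_velocity s \<beta> f x)"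
  unfolding frac_velocity_exists_def has_frac_velocity_def frac_velocity_def
  by (metis tendsto_Lim trivial_limit_at_right_real)

text \<open>Reflecting the argument swaps the two sides, and the outer minus sign keeps the value
  \<open>v\<close> unchanged.\<close>

lemma has_frac_velocity_reflect:
  "has_frac_velocity Forward \<beta> (\<lambda>y. - f (- y)) (- y) v \<longleftrightarrow> has_frac_velocity Backward \<beta> f y v"
  by (simp add: has_frac_velocity_def)

lemma velocity_not_nonzero_on_interval:
  assumes "0 < \<beta>" "\<beta> < 1" "a < b"
    and vel: "\<And>y. \<lbrakk>a < y; y < b\<rbrakk> \<Longrightarrow> \<exists>v. v \<noteq> 0 \<and> has_frac_velocity s \<beta> f y v"
  shows False
proof (cases s)
  case Forward
  with assms show ?thesis using Forward_velocity_not_nonzero_on_interval by blast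
next
  case Backward
  have "\<exists>v. v \<noteq> 0 \<and> has_frac_velocity Forward \<beta> (\<lambda>y. - f (- y)) y v" if "- b < y" "y < - a" for y
    using vel[of "- y"] that Backward has_frac_velocity_reflect[of \<beta> f "- y"] by auto
  with assms show ?thesis
    using Forward_velocity_not_nonzero_on_interval[of \<beta> "- b" "- a"] by force
qed

text \<open>Two distinct points of a connected subset would span an interval of points with nonzero
  velocity.\<close>

lemma totally_disconnected_set_of_change:
  assumes "0 < \<beta>" "\<beta> < 1"
  shows "totally_disconnected (set_of_change s \<beta> f)"
  unfolding totally_disconnected_def
proof (intro allI impI)
  fix T assume T: "T \<subseteq> set_of_change s \<beta> f" "connected T"
  have "\<not> p < q" if "p \<in> T" "q \<in> T" for p q
  proof
    assume "p < q"
    have "\<exists>v. v \<noteq> 0 \<and> has_frac_velocity s \<beta> f y v" if "p < y" "y < q" for y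
    proof -
      have "y \<in> T"
        using connectedD_interval[OF T(2) \<open>p \<in> T\<close> \<open>q \<in> T\<close>] that by simp
      then show ?thesis
        using T(1) has_frac_velocity_frac_velocity unfolding set_of_change_def by blast
    qed
    then show False
      using velocity_not_nonzero_on_interval[OF assms \<open>p < q\<close>] by blast
  qed
  then show "T = {} \<or> (\<exists>a. T = {a})"
    by (metis insertI1 is_singletonI' is_singleton_def linorder_neqE)
qed

text \<open>Continuity would make the velocity exist and stay nonzero on a whole neighbourhood of
  \<open>x\<close>, hence on some interval.\<close>

lemma not_frac_velocity_continuous_at:
  assumes "0 < \<beta>" "\<beta> < 1" "frac_velocity s \<beta> f x \<noteq> 0"
  shows "\<not> frac_velocity_continuous_at s \<beta> f x"
proof
  assume "frac_velocity_continuous_at s \<beta> f x"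
  then have "\<forall>\<^sub>F y in nhds x. frac_velocity_exists s \<beta> f y"
    and "filterlim (frac_velocity s \<beta> f) (nhds (frac_velocity s \<beta> f x)) (nhds x)"
    by (auto simp: frac_velocity_continuous_at_def continuous_at tendsto_at_iff_tendsto_nhds)
  then have "\<forall>\<^sub>F y in nhds x. frac_velocity_exists s \<beta> f y \<and> frac_velocity s \<beta> f y \<noteq> 0"
    using assms(3) tendsto_imp_eventually_ne by (intro eventually_conj)
  then obtain d where d: "0 < d"
    "\<And>y. dist y x < d \<Longrightarrow> frac_velocity_exists s \<beta> f y \<and> frac_velocity s \<beta> f y \<noteq> 0"
    unfolding eventually_nhds_metric by blast
  have "\<exists>v. v \<noteq> 0 \<and> has_frac_velocity s \<beta> f y v" if "x < y" "y < x + d" for y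
    using d(2)[of y] that has_frac_velocity_frac_velocity by (auto simp: dist_real_def)
  then show False
    using velocity_not_nonzero_on_interval[OF assms(1,2), of x "x + d"] d(1) by auto
qed

theorem theorem2:
  fixes \<beta> x :: real and f :: "real \<Rightarrow> real" and s :: side
  assumes "0 < \<beta>" and "\<beta> < 1"
    and "regular_holder_at \<beta> f x"
    and "frac_velocity_exists s \<beta> f x" and "frac_velocity s \<beta> f x \<noteq> 0"
  shows "\<not> frac_velocity_continuous_at s \<beta> f x \<and>
         totally_disconnected (set_of_change Forward \<beta> f)"
  using assms not_frac_velocity_continuous_at totally_disconnected_set_of_change by blast

end
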